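(* Let $A\in\mathbb{R}^{m\times n}$ have full row rank, $\boldsymbol b\in\mathbb{R}^m$ with $\boldsymbol b\ne\mathbf 0$, $\mu>0$, and let the feasible set $\mathcal S$ be either $\mathcal S=\{\boldsymbol x\in\mathbb{R}^n : A\boldsymbol x=\boldsymbol b\}$ (noise-free case) or $\mathcal S=\{\boldsymbol x\in\mathbb{R}^n : \|A\boldsymbol x-\boldsymbol b\|_2^2\le\epsilon^2\}$ with a given $\epsilon>0$ (noisy case). Let $\widehat{\boldsymbol x}\in\mathcal S$ be an $(s,\mu)$-sparse vector. Then $\widehat{\boldsymbol x}$ is a local minimizer of $\min_{\boldsymbol x\in\mathcal S}\Phi_\mu(\boldsymbol x)$. Specifically, there exists $\rho>0$ such that for every $\boldsymbol v\in\mathbb{R}^n$ with $\widehat{\boldsymbol x}+\boldsymbol v\in\mathcal S$ and with $\|\boldsymbol v\|_\infty<\rho$ in the noise-free case (respectively $\|\boldsymbol v\|_\infty<\min\bigl(\rho,\tfrac{\epsilon}{\sqrt n\,\|A\|_2}\bigr)$ in the noisy case), $$\Phi_\mu(\widehat{\boldsymbol x}+\boldsymbol v)\ \ge\ \Phi_\mu(\widehat{\boldsymbol x}).$$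
   Context: The truncated Huber function with parameter $\mu>0$ is $\phi_\mu(x)=\min(1,x^2/\mu^2)$ for $x\in\mathbb{R}$, and $\Phi_\mu(\boldsymbol x)=\sum_{i=1}^n\phi_\mu(\boldsymbol x_i)$ for $\boldsymbol x\in\mathbb{R}^n$. $\|\boldsymbol x\|_0$ is the number of non-zero entries of $\boldsymbol x$ and $\mathrm{supp}(\boldsymbol x)=\{i:\boldsymbol x_i\neq0\}$. A vector $\boldsymbol x\in\mathbb{R}^n$ is $(s,\mu)$-sparse if $\|\boldsymbol x\|_0\le s<n$ and $|\boldsymbol x_i|>\mu$ for all $i\in\mathrm{supp}(\boldsymbol x)$. $\|A\|_2$ is the spectral norm. *)

theory Defs
  imports "HOL-Analysis.Analysis"
begin

definition trunc_huber :: "real \<Rightarrow> real \<Rightarrow> real" where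
  "trunc_huber \<mu> x = min 1 (x\<^sup>2 / \<mu>\<^sup>2)"

definition trunc_huber_sum :: "real \<Rightarrow> real ^ 'n \<Rightarrow> real" where
  "trunc_huber_sum \<mu> x = (\<Sum>i\<in>UNIV. trunc_huber \<mu> (x $ i))"

definition vec_supp :: "real ^ 'n \<Rightarrow> 'n set" where
  "vec_supp x = {i. x $ i \<noteq> 0}"

definition l0_norm :: "real ^ 'n \<Rightarrow> nat" where
  "l0_norm x = card (vec_supp x)"

definition sparse_vec :: "nat \<Rightarrow> real \<Rightarrow> real ^ 'n \<Rightarrow> bool" where
  "sparse_vec s \<mu> x \<longleftrightarrow>
     l0_norm x \<le> s \<and> s < CARD('n) \<and> (\<forall>i\<in>vec_supp x. \<bar>x $ i\<bar> > \<mu>)"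

text \<open>The operator norm induced by the Euclidean norms.\<close>

definition spectral_norm :: "real ^ 'n ^ 'm \<Rightarrow> real" where
  "spectral_norm A = onorm (\<lambda>x. A *v x)"

definition full_row_rank :: "real ^ 'n ^ 'm \<Rightarrow> bool" where
  "full_row_rank A \<longleftrightarrow> rank A = CARD('m)"

definition feasible_exact :: "real ^ 'n ^ 'm \<Rightarrow> real ^ 'm \<Rightarrow> (real ^ 'n) set" where
  "feasible_exact A b = {x. A *v x = b}"

definition feasible_noisy ::
    "real ^ 'n ^ 'm \<Rightarrow> real ^ 'm \<Rightarrow> real \<Rightarrow> (real ^ 'n) set" where
  "feasible_noisy A b \<epsilon> = {x. (norm (A *v x - b))\<^sup>2 \<le> \<epsilon>\<^sup>2}"

definition local_minimizer_on ::
    "('a::metric_space \<Rightarrow> real) \<Rightarrow> 'a set \<Rightarrow> 'a \<Rightarrow> bool" where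
  "local_minimizer_on f S x \<longleftrightarrow>
     x \<in> S \<and> (\<exists>r>0. \<forall>y\<in>S. dist y x < r \<longrightarrow> f x \<le> f y)"

end

theory Submission
  imports Defs
begin

text \<open>
  The function \<open>trunc_huber \<mu>\<close> takes values between \<open>0\<close> and \<open>1\<close>: it attains its minimum \<open>0\<close> at the
  origin and is constant, equal to its maximum \<open>1\<close>, wherever the argument has absolute value at
  least \<open>\<mu>\<close>. Each entry of an \<open>(s, \<mu>)\<close>-sparse vector is either zero, where no
  perturbation can decrease the value, or strictly larger than \<open>\<mu>\<close> in absolute value, where a
  perturbation smaller than the gap to \<open>\<mu>\<close> leaves the value at \<open>1\<close>. As there are finitely many
  entries, one radius \<open>\<rho>\<close> in the supremum norm serves all of them
  (\<open>trunc_huber_sum_local_min\<close>). So the vector is a local minimizer of the separable sum on the whole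
  space, hence on every set that contains it; both feasible sets are instances.
\<close>

lemma trunc_huber_0 [simp]: "trunc_huber \<mu> 0 = 0"
  by (simp add: trunc_huber_def)

lemma trunc_huber_nonneg: "0 \<le> trunc_huber \<mu> x"
  by (simp add: trunc_huber_def)

lemma trunc_huber_le_1: "trunc_huber \<mu> x \<le> 1"
  by (simp add: trunc_huber_def)

lemma trunc_huber_eq_1:
  assumes "\<mu> > 0" and "\<mu> \<le> \<bar>x\<bar>"
  shows "trunc_huber \<mu> x = 1"
proof -
  have "\<mu>\<^sup>2 \<le> x\<^sup>2"
    using assms by (simp add: abs_le_square_iff [symmetric])
  then show ?thesis
    using assms(1) by (simp add: trunc_huber_def min_def le_divide_eq)
qed

text \<open>
  Outside \<open>[-\<mu>, \<mu>]\<close> the radius is the gap \<open>\<bar>x\<bar> - \<mu>\<close>, on which the function stays at its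
  plateau; at the global minimum \<open>0\<close> any radius will do.
\<close>

lemma trunc_huber_local_min:
  assumes "\<mu> > 0" and "x = 0 \<or> \<mu> < \<bar>x\<bar>"
  obtains r where "r > 0" and "\<And>t. \<bar>t\<bar> < r \<Longrightarrow> trunc_huber \<mu> x \<le> trunc_huber \<mu> (x + t)"
proof (cases "x = 0")
  case True
  then show ?thesis
    using that [of 1] by (simp add: trunc_huber_nonneg)
next
  case False
  with assms have gap: "\<bar>x\<bar> - \<mu> > 0" by simp
  have "trunc_huber \<mu> x \<le> trunc_huber \<mu> (x + t)" if "\<bar>t\<bar> < \<bar>x\<bar> - \<mu>" for t
  proof -
    have "trunc_huber \<mu> (x + t) = 1"
      using that by (intro trunc_huber_eq_1 [OF assms(1)]) linarith
    then show ?thesis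
      by (simp add: trunc_huber_le_1)
  qed
  with gap show ?thesis by (rule that)
qed

text \<open>
  The supremum norm bounds every entry of the perturbation at once, so the least of the finitely
  many coordinate radii works for the sum.
\<close>

lemma trunc_huber_sum_local_min:
  fixes x :: "real ^ 'n"
  assumes "\<mu> > 0" and "\<And>i. x $ i = 0 \<or> \<mu> < \<bar>x $ i\<bar>"
  obtains \<rho> where "\<rho> > 0"
    and "\<And>v. infnorm v < \<rho> \<Longrightarrow> trunc_huber_sum \<mu> x \<le> trunc_huber_sum \<mu> (x + v)"
proof -
  have "\<exists>r>0. \<forall>t. \<bar>t\<bar> < r \<longrightarrow> trunc_huber \<mu> (x $ i) \<le> trunc_huber \<mu> (x $ i + t)" for i
    using trunc_huber_local_min [OF assms(1) assms(2) [of i]] by metis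
  then obtain r where r_pos: "\<And>i. r i > 0"
    and r: "\<And>i t. \<bar>t\<bar> < r i \<Longrightarrow> trunc_huber \<mu> (x $ i) \<le> trunc_huber \<mu> (x $ i + t)"
    by metis
  have "Min (range r) > 0"
    by (simp add: r_pos)
  moreover have "trunc_huber_sum \<mu> x \<le> trunc_huber_sum \<mu> (x + v)"
    if "infnorm v < Min (range r)" for v
  proof -
    have "\<bar>v $ i\<bar> < r i" for i
    proof -
      have "\<bar>v $ i\<bar> \<le> infnorm v"
        by (rule component_le_infnorm_cart)
      also have "\<dots> < r i"
        using that by simp
      finally show ?thesis .
    qed
    then show ?thesis
      unfolding trunc_huber_sum_def by (auto intro!: sum_mono r)
  qed
  ultimately show ?thesis by (rule that)
qed

text \<open>
  Passing from the supremum norm to the Euclidean distance costs nothing, since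
  \<open>infnorm v \<le> norm v\<close>.
\<close>

lemma local_minimizer_on_infnormI:
  fixes x :: "'a::euclidean_space"
  assumes "x \<in> S" and "\<rho> > 0" and "\<And>v. infnorm v < \<rho> \<Longrightarrow> f x \<le> f (x + v)"
  shows "local_minimizer_on f S x"
proof -
  have "f x \<le> f y" if "dist y x < \<rho>" for y
    using assms(3) [of "y - x"] that infnorm_le_norm [of "y - x"] by (simp add: dist_norm)
  with assms(1,2) show ?thesis
    unfolding local_minimizer_on_def by blast
qed

theorem theorem2p3:
  fixes A :: "real ^ 'n ^ 'm"
    and b :: "real ^ 'm"
    and \<mu> :: real
    and s :: nat
    and xh :: "real ^ 'n"
  assumes "full_row_rank A"
    and "b \<noteq> 0"
    and "\<mu> > 0"
    and "sparse_vec s \<mu> xh"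
  shows "(xh \<in> feasible_exact A b \<longrightarrow>
            local_minimizer_on (trunc_huber_sum \<mu>) (feasible_exact A b) xh \<and>
            (\<exists>\<rho>>0. \<forall>v. xh + v \<in> feasible_exact A b \<and> infnorm v < \<rho> \<longrightarrow>
               trunc_huber_sum \<mu> (xh + v) \<ge> trunc_huber_sum \<mu> xh)) \<and>
         (\<forall>\<epsilon>>0. xh \<in> feasible_noisy A b \<epsilon> \<longrightarrow>
            local_minimizer_on (trunc_huber_sum \<mu>) (feasible_noisy A b \<epsilon>) xh \<and>
            (\<exists>\<rho>>0. \<forall>v. xh + v \<in> feasible_noisy A b \<epsilon> \<and>
               infnorm v < min \<rho> (\<epsilon> / (sqrt (real CARD('n)) * spectral_norm A)) \<longrightarrow>
               trunc_huber_sum \<mu> (xh + v) \<ge> trunc_huber_sum \<mu> xh))"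
proof -
  have "xh $ i = 0 \<or> \<mu> < \<bar>xh $ i\<bar>" for i
    using assms(4) by (auto simp: sparse_vec_def vec_supp_def)
  then obtain \<rho> where \<rho>: "\<rho> > 0"
    "\<And>v. infnorm v < \<rho> \<Longrightarrow> trunc_huber_sum \<mu> xh \<le> trunc_huber_sum \<mu> (xh + v)"
    using trunc_huber_sum_local_min [OF assms(3)] by blast
  have "local_minimizer_on (trunc_huber_sum \<mu>) S xh" if "xh \<in> S" for S
    using local_minimizer_on_infnormI [OF that \<rho>] .
  with \<rho> show ?thesis
    by (metis min_less_iff_conj)
qed

end
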